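(* Let $\mathbb{X}$ be a two-dimensional real polyhedral Banach space such that $S_{\mathbb{X}}$ is a regular polygon with $4n$ sides, where $n \in \mathbb{N}$, $n \geq 1$. Then $x \in S_{\mathbb{X}}$ is a left-symmetric point in $\mathbb{X}$ if and only if $x$ is the midpoint of some edge of $S_{\mathbb{X}}$.
   Context: For a real Banach space $\mathbb{X}$, $B_{\mathbb{X}} = \{x \in \mathbb{X} : \|x\| \leq 1\}$ and $S_{\mathbb{X}} = \{x \in \mathbb{X} : \|x\| = 1\}$; $\mathbb{X}$ is polyhedral if $B_{\mathbb{X}}$ has only finitely many extreme points. Up to an isomorphism, saying that $S_{\mathbb{X}}$ is a regular polygon with $4n$ sides means that $\mathbb{X} = \mathbb{R}^2$ with the norm whose unit ball $B_{\mathbb{X}}$ is the convex hull of the vertices $v_j = (\cos\frac{2\pi j}{4n}, \sin\frac{2\pi j}{4n})$, $j = 0, 1, \dots, 4n-1$; the edges of $S_{\mathbb{X}}$ are the segments joining cyclically consecutive vertices. For $x,y \in \mathbb{X}$, $x$ is Birkhoff-James orthogonal to $y$, written $x \perp_B y$, if $\|x+\lambda y\| \geq \|x\|$ for all $\lambda \in \mathbb{R}$. An element $x \in \mathbb{X}$ is a left-symmetric point in $\mathbb{X}$ if for every $y \in \mathbb{X}$, $x \perp_B y$ implies $y \perp_B x$. *)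

theory Defs
  imports "HOL-Analysis.Analysis"
begin

definition birkhoff_james_orthogonal :: "'a::real_normed_vector \<Rightarrow> 'a \<Rightarrow> bool"
    (infix "\<bottom>\<^sub>B" 50) where
  "x \<bottom>\<^sub>B y \<longleftrightarrow> (\<forall>t::real. norm (x + t *\<^sub>R y) \<ge> norm x)"

definition left_symmetric :: "'a::real_normed_vector \<Rightarrow> bool" where
  "left_symmetric x \<longleftrightarrow> (\<forall>y. x \<bottom>\<^sub>B y \<longrightarrow> y \<bottom>\<^sub>B x)"

(* The index is not reduced modulo m: by periodicity, polygon_vertex m m = polygon_vertex m 0. *)
definition polygon_vertex :: "nat \<Rightarrow> nat \<Rightarrow> real^2" where
  "polygon_vertex m j = vector [cos (2 * pi * real j / real m), sin (2 * pi * real j / real m)]"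

(* The unit sphere of the normed space 'a is a regular polygon with m sides up to isomorphism:
   T is a linear bijection from the plane onto 'a that carries the standard regular m-gon to the
   closed unit ball, i.e. an isometry onto 'a from the plane normed by that m-gon. *)
definition regular_polygon_sphere_via :: "nat \<Rightarrow> (real^2 \<Rightarrow> 'a::real_normed_vector) \<Rightarrow> bool" where
  "regular_polygon_sphere_via m T \<longleftrightarrow>
     linear T \<and> bij T \<and> cball 0 1 = T ` (convex hull (polygon_vertex m ` {0..<m}))"

(* Endpoints of the edges of the unit sphere of 'a, transported along T. *)
definition edge_endpoints :: "nat \<Rightarrow> (real^2 \<Rightarrow> 'a::real_normed_vector) \<Rightarrow> ('a \<times> 'a) set" where
  "edge_endpoints m T = {(T (polygon_vertex m j), T (polygon_vertex m (Suc j))) | j. j < m}"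

end

theory Submission
  imports Defs
begin

text \<open>
  Let \<open>u\<close> be the unit outer normal of an edge \<open>E\<close>. The functional \<open>\<langle>u, \<cdot>\<rangle>\<close> supports the unit
  ball along all of \<open>E\<close>, and on the cone spanned by \<open>E\<close> the norm is a multiple of it. Hence every
  point of \<open>E\<close> is orthogonal to \<open>ker \<langle>u, \<cdot>\<rangle>\<close>, and a point in the interior of the cone is
  orthogonal to nothing else. Because the number of sides is divisible by four, the kernel is
  spanned by the normal \<open>u'\<close> of another edge, namely \<open>u\<close> turned by a right angle. For \<open>x\<close> in \<open>E\<close>
  we thus have \<open>x \<bottom>\<^sub>B u'\<close>, whereas \<open>u' \<bottom>\<^sub>B x\<close> means \<open>\<langle>u', x\<rangle> = 0\<close>, that is, \<open>x\<close> is a multiple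
  of \<open>u\<close> and hence the midpoint of \<open>E\<close>.
\<close>

lemma birkhoff_james_orthogonal_scaleR:
  fixes x y :: "'a::real_normed_vector"
  assumes "x \<bottom>\<^sub>B y"
  shows "(r *\<^sub>R x) \<bottom>\<^sub>B (s *\<^sub>R y)"
  unfolding birkhoff_james_orthogonal_def
proof
  fix t :: real
  show "norm (r *\<^sub>R x) \<le> norm (r *\<^sub>R x + t *\<^sub>R s *\<^sub>R y)"
  proof (cases "r = 0")
    case False
    then have "r *\<^sub>R x + t *\<^sub>R s *\<^sub>R y = r *\<^sub>R (x + (t * s / r) *\<^sub>R y)"
      by (simp add: scaleR_add_right)
    moreover have "norm x \<le> norm (x + (t * s / r) *\<^sub>R y)"
      using assms unfolding birkhoff_james_orthogonal_def by blast
    ultimately show ?thesis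
      by (simp add: mult_left_mono)
  qed simp
qed

section \<open>Rotated orthonormal frames in the Euclidean plane\<close>

definition unit_vector :: "real \<Rightarrow> real^2" where
  "unit_vector t = vector [cos t, sin t]"

lemma inner_unit_vector: "unit_vector s \<bullet> unit_vector t = cos (s - t)"
  by (simp add: unit_vector_def inner_vec_def sum_2 cos_diff)

lemma unit_vector_periodic: "unit_vector (t + 2 * pi * real k) = unit_vector t"
proof -
  have "2 * pi * real k = 2 * real k * pi"
    by simp
  then show ?thesis
    by (simp only: unit_vector_def cos_add sin_add cos_2npi sin_2npi) simp
qed

lemma unit_vector_add:
  "unit_vector (t + d) = cos d *\<^sub>R unit_vector t + sin d *\<^sub>R unit_vector (t + pi / 2)"
  by (simp add: unit_vector_def vec_eq_iff forall_2 cos_add sin_add)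

lemma unit_vector_expansion:
  "p = (unit_vector t \<bullet> p) *\<^sub>R unit_vector t + (unit_vector (t + pi / 2) \<bullet> p) *\<^sub>R unit_vector (t + pi / 2)"
proof -
  \<comment> \<open>Replaces the squared sine by the squared cosine, in the right-nested shape in
    which \<open>algebra_simps\<close> leaves products.\<close>
  have *: "sin t * (sin t * z) = z - cos t * (cos t * z)" for z
  proof -
    have "sin t * sin t = 1 - cos t * cos t"
      using sin_squared_eq[of t] by (simp only: power2_eq_square)
    then show ?thesis
      by (simp only: left_diff_distrib mult_1 flip: mult.assoc)
  qed
  show ?thesis
    by (simp add: unit_vector_def vec_eq_iff forall_2 inner_vec_def sum_2 cos_add sin_add
        algebra_simps *)
qed

lemma unit_vector_polar:
  obtains r t where "0 \<le> r" "0 \<le> t" "t < 2 * pi" "p = r *\<^sub>R unit_vector t"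
proof (cases "p = 0")
  case True
  then show ?thesis
    using that[of 0 0] by simp
next
  case False
  then have "norm p \<noteq> 0" by simp
  have "(norm p)\<^sup>2 = (p $ 1)\<^sup>2 + (p $ 2)\<^sup>2"
    by (simp add: norm_vec_def L2_set_def sum_2)
  then have "(p $ 1 / norm p)\<^sup>2 + (p $ 2 / norm p)\<^sup>2 = (norm p)\<^sup>2 / (norm p)\<^sup>2"
    by (simp only: power_divide add_divide_distrib)
  then have "(p $ 1 / norm p)\<^sup>2 + (p $ 2 / norm p)\<^sup>2 = 1"
    using \<open>norm p \<noteq> 0\<close> by simp
  from sincos_total_2pi[OF this] obtain t
    where t: "0 \<le> t" "t < 2 * pi" and "p $ 1 / norm p = cos t" "p $ 2 / norm p = sin t"
    by metis
  then have "p $ 1 = norm p * cos t" "p $ 2 = norm p * sin t"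
    using \<open>norm p \<noteq> 0\<close> by (metis mult.commute nonzero_divide_eq_eq)+
  then have "p = norm p *\<^sub>R unit_vector t"
    unfolding vec_eq_iff[of p] by (simp add: unit_vector_def forall_2)
  then show ?thesis
    using t by (intro that[of "norm p" t]) auto
qed

text \<open>With \<open>a = pi / m\<close>, the difference of the two cosines is 2 sin(d a) sin((d +
  1) a). Consecutive multiples of \<open>a\<close> never lie strictly on opposite sides of a
  multiple of pi, so the two sines do not have opposite signs. For \<open>m = 4 * n\<close> this
  bounds the inner product of an edge normal with a vertex.\<close>

lemma cos_odd_multiple_le:
  fixes d :: int
  assumes "0 < m"
  shows "cos ((2 * of_int d + 1) * (pi / real m)) \<le> cos (pi / real m)"
proof -
  define a where "a = pi / real m"
  define q where "q = d div int m"
  define r where "r = d mod int m"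
  have r: "0 \<le> r" "r < int m" and d: "d = q * int m + r"
    using assms by (auto simp: q_def r_def)
  have am: "real m * a = pi" "0 < a"
    using assms by (auto simp: a_def)
  have da: "of_int d * a = of_int q * pi + of_int r * a"
    using am by (simp add: d algebra_simps)
  \<comment> \<open>The factor \<open>cos (of_int q * pi)\<close> is a sign; it occurs in both
    sines, so only its square enters the product.\<close>
  have sgn: "sin (of_int q * pi + y) = cos (of_int q * pi) * sin y" for y
    by (simp add: sin_add sin_zero_iff_int2)
  \<comment> \<open>The endpoint \<open>i = int m\<close> is included because \<open>r + 1\<close>
    can reach it.\<close>
  have sin1: "0 \<le> sin (of_int i * a)" if "0 \<le> i" "i \<le> int m" for i :: int
  proof (rule sin_ge_zero)
    have "of_int i * a \<le> real m * a"
      using that am by (intro mult_right_mono) auto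
    then show "of_int i * a \<le> pi" using am by simp
  qed (use that am in auto)
  have "0 \<le> (cos (of_int q * pi))\<^sup>2 * (sin (of_int r * a) * sin (of_int (r + 1) * a))"
    using r by (intro mult_nonneg_nonneg sin1) auto
  also have "\<dots> = sin (of_int d * a) * sin ((of_int d + 1) * a)"
  proof -
    have "(of_int d + 1) * a = of_int q * pi + of_int (r + 1) * a"
      using da by (simp add: algebra_simps)
    then have "sin ((of_int d + 1) * a) = cos (of_int q * pi) * sin (of_int (r + 1) * a)"
      by (simp only: sgn)
    then show ?thesis
      unfolding da sgn by (simp only: power2_eq_square mult_ac)
  qed
  also have "\<dots> = (cos a - cos ((2 * of_int d + 1) * a)) / 2"
    by (simp add: sin_times_sin algebra_simps)
  finally show ?thesis
    by (simp add: a_def)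
qed

section \<open>Edge normals and vertices of the polygon\<close>

locale regular_polygon_norm =
  fixes n :: nat and T :: "real^2 \<Rightarrow> 'a::real_normed_vector"
  assumes n_pos: "0 < n" and via: "regular_polygon_sphere_via (4 * n) T"
begin

text \<open>Half the angle that an edge subtends at the centre; \<open>cos \<alpha>\<close> is the
  Euclidean distance from the centre to each edge.\<close>

definition \<alpha> :: real where "\<alpha> = pi / real (4 * n)"

text \<open>Euclidean unit outer normal of the edge from vertex \<open>k\<close> to vertex
  \<open>Suc k\<close>. Indices are not reduced modulo \<open>4 * n\<close>, so
  \<open>normal (k + n)\<close> is the quarter turn of \<open>normal k\<close> for every
  \<open>k\<close>.\<close>

definition normal :: "nat \<Rightarrow> real^2" where
  "normal k = unit_vector ((2 * real k + 1) * \<alpha>)"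

lemma linear_T: "linear T"
  using via unfolding regular_polygon_sphere_via_def by blast

sublocale T: linear T
  by (rule linear_T)

lemma surj_T: "surj T"
  using via unfolding regular_polygon_sphere_via_def bij_def by blast

lemma norm_T_le_1_iff: "norm (T p) \<le> 1 \<longleftrightarrow> p \<in> convex hull (polygon_vertex (4 * n) ` {0..<4 * n})"
proof -
  have "inj T" and "cball 0 1 = T ` (convex hull (polygon_vertex (4 * n) ` {0..<4 * n}))"
    using via unfolding regular_polygon_sphere_via_def bij_def by blast+
  moreover have "norm (T p) \<le> 1 \<longleftrightarrow> T p \<in> cball 0 1"
    by simp
  ultimately show ?thesis
    by (metis inj_image_mem_iff)
qed

lemma \<alpha>_bounds: "0 < \<alpha>" "\<alpha> < pi / 2"
  using n_pos by (auto simp: \<alpha>_def field_simps)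

lemma \<alpha>_times_n: "4 * (real n * \<alpha>) = pi"
  using n_pos by (simp add: \<alpha>_def)

lemma cos_\<alpha>_pos: "0 < cos \<alpha>"
  using \<alpha>_bounds by (intro cos_gt_zero) auto

lemma sin_\<alpha>_pos: "0 < sin \<alpha>"
  using \<alpha>_bounds by (intro sin_gt_zero) auto

text \<open>The only use of the divisibility of the number of sides by four.\<close>

lemma normal_add_n: "normal (k + n) = unit_vector ((2 * real k + 1) * \<alpha> + pi / 2)"
proof -
  have "(2 * real (k + n) + 1) * \<alpha> = (2 * real k + 1) * \<alpha> + 4 * (real n * \<alpha>) / 2"
    by (simp add: algebra_simps)
  then show ?thesis
    by (simp only: normal_def \<alpha>_times_n)
qed

lemma normal_expansion:
  "p = (normal k \<bullet> p) *\<^sub>R normal k + (normal (k + n) \<bullet> p) *\<^sub>R normal (k + n)"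
  unfolding normal_add_n by (unfold normal_def) (rule unit_vector_expansion)

lemma inner_normal [simp]:
  "normal k \<bullet> normal k = 1"
  "normal k \<bullet> normal (k + n) = 0"
  "normal (k + n) \<bullet> normal k = 0"
  unfolding normal_add_n by (simp_all add: normal_def inner_unit_vector)

lemma polygon_vertex_eq: "polygon_vertex (4 * n) k = unit_vector (2 * real k * \<alpha>)"
  by (simp add: polygon_vertex_def unit_vector_def \<alpha>_def mult_ac)

lemma polygon_vertex_left:
  "polygon_vertex (4 * n) k = cos \<alpha> *\<^sub>R normal k - sin \<alpha> *\<^sub>R normal (k + n)"
  using unit_vector_add[of "(2 * real k + 1) * \<alpha>" "- \<alpha>"]
  by (simp add: polygon_vertex_eq normal_add_n) (simp add: normal_def algebra_simps)

lemma polygon_vertex_right: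
  "polygon_vertex (4 * n) (Suc k) = cos \<alpha> *\<^sub>R normal k + sin \<alpha> *\<^sub>R normal (k + n)"
  using unit_vector_add[of "(2 * real k + 1) * \<alpha>" "\<alpha>"]
  by (simp add: polygon_vertex_eq normal_add_n) (simp add: normal_def algebra_simps)

lemma midpoint_edge:
  "midpoint (T (polygon_vertex (4 * n) k)) (T (polygon_vertex (4 * n) (Suc k))) = cos \<alpha> *\<^sub>R T (normal k)"
  unfolding midpoint_def polygon_vertex_left[of k] polygon_vertex_right[of k]
  by (simp add: T.add T.diff T.scale flip: scaleR_2)

section \<open>The norm on the cone over an edge\<close>

lemma norm_T_vertex_le: "norm (T (polygon_vertex (4 * n) k)) \<le> 1"
proof -
  \<comment> \<open>The hull is generated by indices below \<open>4 * n\<close>, whereas the right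
    end of the last edge has index \<open>4 * n\<close>.\<close>
  define q where "q = k div (4 * n)"
  define r where "r = k mod (4 * n)"
  have "real k = real (4 * n) * real q + real r"
    unfolding q_def r_def by (simp flip: of_nat_mult of_nat_add)
  then have "2 * real k * \<alpha> = 2 * real r * \<alpha> + 2 * (4 * (real n * \<alpha>)) * real q"
    by (simp add: algebra_simps)
  then have "2 * real k * \<alpha> = 2 * real r * \<alpha> + 2 * pi * real q"
    by (simp only: \<alpha>_times_n)
  then have "polygon_vertex (4 * n) k = polygon_vertex (4 * n) r"
    by (simp only: polygon_vertex_eq unit_vector_periodic)
  moreover have "r < 4 * n"
    using n_pos by (simp add: r_def)
  ultimately show ?thesis
    unfolding norm_T_le_1_iff by (auto intro!: hull_inc)
qed

lemma inner_normal_vertex_le: "normal k \<bullet> polygon_vertex (4 * n) j \<le> cos \<alpha>"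
proof -
  have "normal k \<bullet> polygon_vertex (4 * n) j = cos ((2 * of_int (int k - int j) + 1) * \<alpha>)"
    unfolding normal_def polygon_vertex_eq inner_unit_vector by (simp add: algebra_simps)
  also have "\<dots> \<le> cos \<alpha>"
    unfolding \<alpha>_def using n_pos by (intro cos_odd_multiple_le) simp
  finally show ?thesis .
qed

text \<open>The half-plane bounded by the line through edge \<open>k\<close> contains all vertices,
  hence their convex hull, the unit ball. Scaling extends the bound to every
  \<open>p\<close>.\<close>

lemma inner_normal_le: "normal k \<bullet> p \<le> cos \<alpha> * norm (T p)"
proof (cases "T p = 0")
  case True
  then have "p = 0"
    using via T.zero unfolding regular_polygon_sphere_via_def bij_def by (metis injD)
  then show ?thesis by (simp add: T.zero)
next
  case False
  define q where "q = (1 / norm (T p)) *\<^sub>R p"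
  have "norm (T q) \<le> 1"
    using False by (simp add: q_def T.scale)
  then have "q \<in> convex hull (polygon_vertex (4 * n) ` {0..<4 * n})"
    by (simp only: norm_T_le_1_iff)
  also have "\<dots> \<subseteq> {z. normal k \<bullet> z \<le> cos \<alpha>}"
    by (intro hull_minimal convex_halfspace_le) (use inner_normal_vertex_le in auto)
  finally have "normal k \<bullet> p / norm (T p) \<le> cos \<alpha>"
    by (simp add: q_def)
  then show ?thesis
    using False by (simp add: field_simps)
qed

text \<open>The hypothesis places the point in the cone spanned by vertices \<open>k\<close> and
  \<open>Suc k\<close>. The triangle inequality bounds its norm above by the sum of its coefficients
  there, the functional of \<open>normal k\<close> bounds it below, and the bounds agree.\<close>

lemma norm_T_cone:
  assumes "\<bar>b\<bar> * cos \<alpha> \<le> a * sin \<alpha>"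
  shows "cos \<alpha> * norm (T (a *\<^sub>R normal k + b *\<^sub>R normal (k + n))) = a"
proof (rule antisym)
  let ?v = "polygon_vertex (4 * n)"
  let ?p = "a *\<^sub>R normal k + b *\<^sub>R normal (k + n)"
  \<comment> \<open>Coordinates with respect to the two vertices, from solving
    \<open>(l + r) * cos \<alpha> = a\<close> and \<open>(r - l) * sin \<alpha> = b\<close>.\<close>
  define l where "l = (a / cos \<alpha> - b / sin \<alpha>) / 2"
  define r where "r = (a / cos \<alpha> + b / sin \<alpha>) / 2"
  have "b * cos \<alpha> \<le> \<bar>b\<bar> * cos \<alpha>" "- b * cos \<alpha> \<le> \<bar>b\<bar> * cos \<alpha>"
    using cos_\<alpha>_pos by (intro mult_right_mono; simp)+
  then have "b * cos \<alpha> \<le> a * sin \<alpha>" "- b * cos \<alpha> \<le> a * sin \<alpha>"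
    using assms by linarith+
  then have "0 \<le> l" "0 \<le> r"
    using cos_\<alpha>_pos sin_\<alpha>_pos by (auto simp: l_def r_def field_simps)
  have "(l + r) * cos \<alpha> = a" "(r - l) * sin \<alpha> = b"
    using cos_\<alpha>_pos sin_\<alpha>_pos by (auto simp: l_def r_def field_simps)
  then have "?p = l *\<^sub>R ?v k + r *\<^sub>R ?v (Suc k)"
    unfolding polygon_vertex_left[of k] polygon_vertex_right[of k] by (auto simp: algebra_simps)
  then have "norm (T ?p) \<le> l * norm (T (?v k)) + r * norm (T (?v (Suc k)))"
    using \<open>0 \<le> l\<close> \<open>0 \<le> r\<close> norm_triangle_ineq[of "l *\<^sub>R T (?v k)" "r *\<^sub>R T (?v (Suc k))"]
    by (simp add: T.add T.scale)
  also have "\<dots> \<le> l * 1 + r * 1"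
    using \<open>0 \<le> l\<close> \<open>0 \<le> r\<close> by (intro add_mono mult_left_mono norm_T_vertex_le)
  finally show "cos \<alpha> * norm (T ?p) \<le> a"
    using cos_\<alpha>_pos \<open>(l + r) * cos \<alpha> = a\<close> by (metis mult.commute mult_le_cancel_left_pos mult_1)
  show "a \<le> cos \<alpha> * norm (T ?p)"
    using inner_normal_le[of k ?p] by (simp add: inner_add_right)
qed

section \<open>Birkhoff-James orthogonality on the cones\<close>

lemma cone_orthogonal:
  assumes "\<bar>b\<bar> * cos \<alpha> \<le> a * sin \<alpha>" and "normal k \<bullet> q = 0"
  shows "T (a *\<^sub>R normal k + b *\<^sub>R normal (k + n)) \<bottom>\<^sub>B T q"
  unfolding birkhoff_james_orthogonal_def
proof
  fix t :: real
  let ?p = "a *\<^sub>R normal k + b *\<^sub>R normal (k + n)"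
  \<comment> \<open>Multiples of \<open>q\<close> do not change the value of the functional, and at
    \<open>?p\<close> this value computes the norm.\<close>
  have "cos \<alpha> * norm (T ?p) = normal k \<bullet> (?p + t *\<^sub>R q)"
    using assms by (simp add: norm_T_cone inner_add_right)
  also have "\<dots> \<le> cos \<alpha> * norm (T ?p + t *\<^sub>R T q)"
    using inner_normal_le[of k "?p + t *\<^sub>R q"] by (simp add: T.add T.scale)
  finally show "norm (T ?p) \<le> norm (T ?p + t *\<^sub>R T q)"
    using cos_\<alpha>_pos by simp
qed

text \<open>As \<open>normal k\<close> is interior to the cone over its edge, the norm is affine
  along a short segment through it in direction \<open>q\<close>, with slope proportional to
  \<open>normal k \<bullet> q\<close>. A minimum at an interior point of the segment forces slope
  zero.\<close>

lemma normal_orthogonal_iff: "T (normal k) \<bottom>\<^sub>B T q \<longleftrightarrow> normal k \<bullet> q = 0"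
proof
  assume orth: "T (normal k) \<bottom>\<^sub>B T q"
  define a where "a = normal k \<bullet> q"
  define b where "b = normal (k + n) \<bullet> q"
  have q: "q = a *\<^sub>R normal k + b *\<^sub>R normal (k + n)"
    unfolding a_def b_def by (rule normal_expansion)
  \<comment> \<open>Small enough that \<open>normal k + t *\<^sub>R q\<close> stays in the cone for
    \<open>\<bar>t\<bar> = e\<close>; the summand 1 keeps the denominator positive when
    \<open>q = 0\<close>.\<close>
  define e where "e = sin \<alpha> / (\<bar>b\<bar> * cos \<alpha> + \<bar>a\<bar> * sin \<alpha> + 1)"
  have den: "0 < \<bar>b\<bar> * cos \<alpha> + \<bar>a\<bar> * sin \<alpha> + 1"
    using cos_\<alpha>_pos sin_\<alpha>_pos by (intro add_nonneg_pos) auto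
  have "0 < e"
    using den sin_\<alpha>_pos by (simp add: e_def)
  have "e * (\<bar>b\<bar> * cos \<alpha> + \<bar>a\<bar> * sin \<alpha> + 1) = sin \<alpha>"
    using den by (simp add: e_def)
  then have e: "e * \<bar>b\<bar> * cos \<alpha> + e * \<bar>a\<bar> * sin \<alpha> \<le> sin \<alpha>"
    using \<open>0 < e\<close> by (simp add: algebra_simps)
  have small: "0 \<le> t * a" if "\<bar>t\<bar> = e" for t
  proof -
    have "- (t * a) \<le> e * \<bar>a\<bar>"
      using that abs_ge_minus_self[of "t * a"] by (simp add: abs_mult)
    then have "- (t * a) * sin \<alpha> \<le> e * \<bar>a\<bar> * sin \<alpha>"
      using sin_\<alpha>_pos by (intro mult_right_mono) auto
    then have cone: "\<bar>t * b\<bar> * cos \<alpha> \<le> (1 + t * a) * sin \<alpha>"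
      using e that by (simp add: abs_mult algebra_simps)
    have "T (normal k) + t *\<^sub>R T q = T ((1 + t * a) *\<^sub>R normal k + (t * b) *\<^sub>R normal (k + n))"
      unfolding q by (simp add: T.add T.scale algebra_simps)
    then have "cos \<alpha> * norm (T (normal k) + t *\<^sub>R T q) = 1 + t * a"
      using norm_T_cone[OF cone] by simp
    moreover have "cos \<alpha> * norm (T (normal k)) = 1"
      using norm_T_cone[of 0 1 k] sin_\<alpha>_pos by simp
    moreover have "cos \<alpha> * norm (T (normal k)) \<le> cos \<alpha> * norm (T (normal k) + t *\<^sub>R T q)"
      using orth cos_\<alpha>_pos unfolding birkhoff_james_orthogonal_def by simp
    ultimately show ?thesis by linarith
  qed
  have "0 \<le> e * a" "0 \<le> (- e) * a"
    using \<open>0 < e\<close> by (intro small; simp)+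
  then show "normal k \<bullet> q = 0"
    using \<open>0 < e\<close> by (simp add: a_def[symmetric] zero_le_mult_iff mult_le_0_iff)
next
  assume "normal k \<bullet> q = 0"
  then show "T (normal k) \<bottom>\<^sub>B T q"
    using cone_orthogonal[of 0 1 k q] sin_\<alpha>_pos by simp
qed

lemma cone_cover:
  obtains k a b where "k < 4 * n" "p = a *\<^sub>R normal k + b *\<^sub>R normal (k + n)"
    "\<bar>b\<bar> * cos \<alpha> \<le> a * sin \<alpha>"
proof -
  obtain r t where r: "0 \<le> r" and t: "0 \<le> t" "t < 2 * pi" and p: "p = r *\<^sub>R unit_vector t"
    by (rule unit_vector_polar)
  \<comment> \<open>The index of the sector of width \<open>2 * \<alpha>\<close> containing the
    angle \<open>t\<close>; \<open>d\<close> is the deviation from its bisector, which points along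
    \<open>normal k\<close>.\<close>
  define k where "k = nat \<lfloor>t / (2 * \<alpha>)\<rfloor>"
  define d where "d = t - (2 * real k + 1) * \<alpha>"
  have "0 \<le> t / (2 * \<alpha>)"
    using t \<alpha>_bounds by simp
  then have k: "real k \<le> t / (2 * \<alpha>)" "t / (2 * \<alpha>) < real k + 1"
    unfolding k_def by linarith+
  have "\<bar>d\<bar> \<le> \<alpha>"
    using k \<alpha>_bounds by (auto simp: d_def field_simps abs_le_iff)
  have "t / (2 * \<alpha>) < real (4 * n)"
    using t \<alpha>_bounds \<alpha>_times_n by (simp add: field_simps)
  then have "k < 4 * n"
    using k by linarith
  moreover have "p = (r * cos d) *\<^sub>R normal k + (r * sin d) *\<^sub>R normal (k + n)"
    using unit_vector_add[of "(2 * real k + 1) * \<alpha>" d]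
    unfolding p normal_add_n by (simp add: normal_def d_def scaleR_add_right)
  moreover have "\<bar>r * sin d\<bar> * cos \<alpha> \<le> (r * cos d) * sin \<alpha>"
  proof -
    \<comment> \<open>By the addition formulas, these two signs are the two halves of the cone
      inequality.\<close>
    have "0 \<le> sin (\<alpha> - d)" "0 \<le> sin (\<alpha> + d)"
      using \<open>\<bar>d\<bar> \<le> \<alpha>\<close> \<alpha>_bounds by (auto intro!: sin_ge_zero)
    then have "\<bar>sin d\<bar> * cos \<alpha> \<le> cos d * sin \<alpha>"
      by (auto simp: sin_add sin_diff abs_if mult_ac)
    then show ?thesis
      using r by (simp add: abs_mult mult.assoc mult_left_mono)
  qed
  ultimately show ?thesis by (rule that)
qed

section \<open>Left-symmetric points and edge midpoints\<close>

lemma left_symmetric_edge_midpoint: "left_symmetric (cos \<alpha> *\<^sub>R T (normal k))"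
  unfolding left_symmetric_def
proof (intro allI impI)
  fix y assume y: "(cos \<alpha> *\<^sub>R T (normal k)) \<bottom>\<^sub>B y"
  obtain q where q: "y = T q"
    using surj_T by blast
  have "T (normal k) \<bottom>\<^sub>B T q"
    using birkhoff_james_orthogonal_scaleR[OF y, of "1 / cos \<alpha>" 1] cos_\<alpha>_pos q by simp
  then have "normal k \<bullet> q = 0"
    by (simp only: normal_orthogonal_iff)
  \<comment> \<open>The kernel of the functional is the line of another edge normal, so the
    orthogonality criterion for normals applies again with the roles exchanged.\<close>
  then have "y = (normal (k + n) \<bullet> q) *\<^sub>R T (normal (k + n))"
    using normal_expansion[of q k] q by (simp flip: T.scale)
  moreover have "T (normal (k + n)) \<bottom>\<^sub>B T (normal k)"
    by (simp add: normal_orthogonal_iff)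
  ultimately show "y \<bottom>\<^sub>B (cos \<alpha> *\<^sub>R T (normal k))"
    by (metis birkhoff_james_orthogonal_scaleR)
qed

lemma left_symmetric_imp_edge_midpoint:
  assumes "left_symmetric x" "norm x = 1"
  obtains k where "k < 4 * n" "x = cos \<alpha> *\<^sub>R T (normal k)"
proof -
  obtain p where p: "x = T p"
    using surj_T by blast
  obtain k a b where k: "k < 4 * n" and pab: "p = a *\<^sub>R normal k + b *\<^sub>R normal (k + n)"
    and cone: "\<bar>b\<bar> * cos \<alpha> \<le> a * sin \<alpha>"
    by (rule cone_cover)
  have "a = cos \<alpha>"
    using norm_T_cone[OF cone, of k] assms(2) p pab by simp
  have "x \<bottom>\<^sub>B T (normal (k + n))"
    using cone_orthogonal[OF cone] p pab by simp
  \<comment> \<open>Reversing the relation puts a normal on the left, where the criterion is exact;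
    it says that the coordinate \<open>b\<close> along the edge vanishes.\<close>
  then have "T (normal (k + n)) \<bottom>\<^sub>B T p"
    using assms(1) p unfolding left_symmetric_def by blast
  then have "b = 0"
    by (simp add: normal_orthogonal_iff pab inner_add_right)
  with \<open>a = cos \<alpha>\<close> k p pab show ?thesis
    by (intro that[of k]) (simp_all add: T.scale)
qed

end

theorem theorem2p6:
  fixes T :: "real^2 \<Rightarrow> 'a::banach" and n :: nat and x :: 'a
  assumes "n \<ge> 1"
    and "dim (UNIV :: 'a set) = 2"
    and "finite {e :: 'a. e extreme_point_of cball 0 1}"
    and "regular_polygon_sphere_via (4 * n) T"
    and "x \<in> sphere 0 1"
  shows "left_symmetric x \<longleftrightarrow> (\<exists>(a, b) \<in> edge_endpoints (4 * n) T. x = midpoint a b)"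
proof -
  interpret regular_polygon_norm n T
    using assms by unfold_locales auto
  have "(\<exists>(a, b) \<in> edge_endpoints (4 * n) T. x = midpoint a b)
      \<longleftrightarrow> (\<exists>k < 4 * n. x = cos \<alpha> *\<^sub>R T (normal k))"
    unfolding edge_endpoints_def by (force simp: midpoint_edge)
  moreover have "norm x = 1"
    using assms(5) by simp
  ultimately show ?thesis
    using left_symmetric_edge_midpoint left_symmetric_imp_edge_midpoint by metis
qed

end
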